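(* Let $p:\mathbb{R}^n\to\mathbb{R}$ be a polynomial with real coefficients that can be written as the sum of a univariate polynomial (i.e., a polynomial in a single one of the variables $x_1,\dots,x_n$) and a quadratic polynomial in $x=(x_1,\dots,x_n)$. If $p(x)$ is nonnegative, then it can be written as the sum of a nonnegative univariate polynomial and a nonnegative quadratic polynomial. In particular, $p(x)$ is nonnegative if and only if it is a sum of squares.
   Context: All polynomials have real coefficients. A polynomial $p:\mathbb{R}^n\to\mathbb{R}$ is nonnegative if $p(x)\ge 0$ for all $x\in\mathbb{R}^n$. It is a sum of squares (sos) if $p=\sum_{i=1}^m q_i^2$ for some polynomials $q_1,\dots,q_m$ in $x$. A quadratic polynomial is a polynomial of degree at most $2$ (not necessarily homogeneous). *)

theory Defs
  imports "HOL-Analysis.Analysis" "HOL-Computational_Algebra.Polynomial"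
begin

text \<open>
  A polynomial in \<open>x\<^sub>1, \<dots>, x\<^sub>n\<close> with real coefficients is identified with the function on
  \<^typ>\<open>real ^ 'n\<close> that it induces; since the field of reals is infinite, this loses nothing.
  The predicate \<^const>\<open>real_polynomial_function\<close> of the library is used for such functions.
\<close>

definition univariate_polynomial :: "(real ^ 'n \<Rightarrow> real) \<Rightarrow> bool" where
  "univariate_polynomial u \<longleftrightarrow> (\<exists>(i::'n) (f::real poly). u = (\<lambda>x. poly f (x $ i)))"

text \<open>
  Here \<open>\<alpha>\<close> ranges over the exponent vectors of total degree at most \<open>d\<close>; there are finitely many
  of them, see \<open>finite_exponents\<close> below.
\<close>

definition polynomial_degree_le :: "nat \<Rightarrow> (real ^ 'n \<Rightarrow> real) \<Rightarrow> bool" where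
  "polynomial_degree_le d p \<longleftrightarrow>
     (\<exists>c :: ('n \<Rightarrow> nat) \<Rightarrow> real.
        p = (\<lambda>x. \<Sum>\<alpha> | (\<Sum>i\<in>UNIV. \<alpha> i) \<le> d. c \<alpha> * (\<Prod>i\<in>UNIV. x $ i ^ \<alpha> i)))"

definition quadratic_polynomial :: "(real ^ 'n \<Rightarrow> real) \<Rightarrow> bool" where
  "quadratic_polynomial q \<longleftrightarrow> polynomial_degree_le 2 q"

definition nonnegative :: "(real ^ 'n \<Rightarrow> real) \<Rightarrow> bool" where
  "nonnegative p \<longleftrightarrow> (\<forall>x. p x \<ge> 0)"

definition sos :: "(real ^ 'n \<Rightarrow> real) \<Rightarrow> bool" where
  "sos p \<longleftrightarrow> (\<exists>(m::nat) (q :: nat \<Rightarrow> real ^ 'n \<Rightarrow> real).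
     (\<forall>i\<in>{1..m}. real_polynomial_function (q i)) \<and> p = (\<lambda>x. \<Sum>i=1..m. (q i x)\<^sup>2))"

lemma finite_exponents: "finite {\<alpha> :: 'n::finite \<Rightarrow> nat. (\<Sum>i\<in>UNIV. \<alpha> i) \<le> d}"
proof (rule finite_subset)
  show "{\<alpha> :: 'n \<Rightarrow> nat. (\<Sum>i\<in>UNIV. \<alpha> i) \<le> d} \<subseteq> (UNIV :: 'n set) \<rightarrow>\<^sub>E {..d}"
  proof
    fix \<alpha> :: "'n \<Rightarrow> nat"
    assume "\<alpha> \<in> {\<alpha>. (\<Sum>i\<in>UNIV. \<alpha> i) \<le> d}"
    moreover have "\<alpha> i \<le> (\<Sum>i\<in>UNIV. \<alpha> i)" for i
      by (rule member_le_sum) auto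
    ultimately show "\<alpha> \<in> UNIV \<rightarrow>\<^sub>E {..d}"
      by (auto intro: order_trans)
  qed
  show "finite ((UNIV :: 'n set) \<rightarrow>\<^sub>E {..d})"
    by (intro finite_PiE) auto
qed

lemma polynomial_degree_le_imp_real_polynomial_function:
  assumes "polynomial_degree_le d (p :: real ^ 'n \<Rightarrow> real)"
  shows "real_polynomial_function p"
proof -
  have coord: "real_polynomial_function (\<lambda>x :: real ^ 'n. x $ i)" for i
    by (intro real_polynomial_function.intros(1) bounded_linear_vec_nth)
  have "real_polynomial_function (\<lambda>x :: real ^ 'n. \<Prod>i\<in>UNIV. x $ i ^ \<alpha> i)" for \<alpha> :: "'n \<Rightarrow> nat"
    by (intro real_polynomial_function_prod real_polynomial_function_power coord) auto
  then show ?thesis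
    using assms unfolding polynomial_degree_le_def
    by (auto intro!: real_polynomial_function_sum real_polynomial_function.intros(4)
        real_polynomial_function.intros(2) finite_exponents)
qed

end

theory Submission
  imports Defs "HOL-Computational_Algebra.Fundamental_Theorem_Algebra"
begin

text \<open>Let x_i be the variable of the univariate part. Absorbing the pure powers of x_i from
  the quadratic part, \<open>p\<close> becomes f(x_i), plus terms linear in the other variables with
  coefficients affine in x_i, plus a quadratic form in the other variables with constant
  coefficients (\<open>quadratic_expansion_split\<close>). With respect to another variable x_j this
  reads a x_j^2 + l x_j + r, where a is a constant, l is affine and neither l nor r involves x_j.
  Nonnegativity forces a \<ge> 0 (\<open>nonneg_quadratic_coeffs\<close>). If a = 0 then l = 0 and
  x_j does not occur. If a > 0 then p = a (x_j + l/(2a))^2 + (r - l^2/(4a)); the remainder is the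
  minimum over x_j, hence nonnegative, and it has the same shape in one variable fewer because l^2
  is quadratic.

  Eliminating every variable but x_i (\<open>nonneg_partially_quadratic_decomposition\<close>)
  leaves a nonnegative v(x_i) plus squares of affine functions, which form a nonnegative quadratic
  polynomial. Finally v is itself a sum of squares (\<open>nonneg_poly_sos\<close>), since
  subtracting its minimum leaves a double root times a nonnegative polynomial of lower
  degree.\<close>

section \<open>Closure properties of sums of squares\<close>

lemma sos_zero: "sos (\<lambda>x. 0)"
  unfolding sos_def by (rule exI[of _ 0]) auto

lemma sos_add_square:
  fixes p g :: "real ^ 'n \<Rightarrow> real"
  assumes "sos p" "real_polynomial_function g"
  shows "sos (\<lambda>x. p x + (g x)\<^sup>2)"
proof -
  obtain m q where q: "\<forall>i\<in>{1..m::nat}. real_polynomial_function (q i)"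
    and p: "p = (\<lambda>x. \<Sum>i=1..m. (q i x)\<^sup>2)"
    using assms(1) unfolding sos_def by blast
  have "(\<Sum>i=1..Suc m. ((q(Suc m := g)) i x)\<^sup>2) = p x + (g x)\<^sup>2" for x
  proof -
    have "(\<Sum>i=1..m. ((q(Suc m := g)) i x)\<^sup>2) = (\<Sum>i=1..m. (q i x)\<^sup>2)"
      by (intro sum.cong) auto
    then show ?thesis unfolding p by simp
  qed
  moreover have "\<forall>i\<in>{1..Suc m}. real_polynomial_function ((q(Suc m := g)) i)"
    using q assms(2) by auto
  ultimately show ?thesis
    unfolding sos_def by (intro exI[of _ "Suc m"] exI[of _ "q(Suc m := g)"]) simp
qed

text \<open>Appending the squares of \<open>q\<close> one at a time reduces this to
  \<open>sos_add_square\<close> and avoids concatenating two index ranges.\<close>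

lemma sos_add:
  fixes p q :: "real ^ 'n \<Rightarrow> real"
  assumes "sos p" "sos q"
  shows "sos (\<lambda>x. p x + q x)"
proof -
  obtain m h where h: "\<forall>i\<in>{1..m::nat}. real_polynomial_function (h i)"
    and q: "q = (\<lambda>x. \<Sum>i=1..m. (h i x)\<^sup>2)"
    using assms(2) unfolding sos_def by blast
  have "sos (\<lambda>x. p x + (\<Sum>i=1..k. (h i x)\<^sup>2))" if "k \<le> m" for k
    using that
  proof (induction k)
    case 0
    then show ?case using assms(1) by simp
  next
    case (Suc k)
    then have "sos (\<lambda>x. (p x + (\<Sum>i=1..k. (h i x)\<^sup>2)) + (h (Suc k) x)\<^sup>2)"
      using h by (intro sos_add_square) auto
    then show ?case by (simp add: add.assoc)
  qed
  then show ?thesis unfolding q by blast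
qed

lemma sos_mult_square:
  fixes p g :: "real ^ 'n \<Rightarrow> real"
  assumes "sos p" "real_polynomial_function g"
  shows "sos (\<lambda>x. (g x)\<^sup>2 * p x)"
proof -
  obtain m q where "\<forall>i\<in>{1..m::nat}. real_polynomial_function (q i)"
    and "p = (\<lambda>x. \<Sum>i=1..m. (q i x)\<^sup>2)"
    using assms(1) unfolding sos_def by blast
  then show ?thesis
    unfolding sos_def using assms(2)
    by (intro exI[of _ m] exI[of _ "\<lambda>i x. g x * q i x"])
       (auto simp: sum_distrib_left power_mult_distrib intro: real_polynomial_function.intros(4))
qed

lemma sos_const:
  assumes "c \<ge> 0"
  shows "sos (\<lambda>x. c)"
  using sos_add_square[OF sos_zero real_polynomial_function.intros(2), of "sqrt c"] assms by simp

lemma sos_imp_nonnegative: "sos p \<Longrightarrow> nonnegative p"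
  unfolding sos_def nonnegative_def by (auto intro: sum_nonneg)

lemma real_polynomial_function_coord: "real_polynomial_function (\<lambda>x :: real ^ 'n. x $ i)"
  by (intro real_polynomial_function.intros(1) bounded_linear_vec_nth)

section \<open>Nonnegative univariate polynomials\<close>

text \<open>A nonconstant polynomial is large in absolute value far out, so a nonnegative one is at
  least its value at 0 there; on the remaining compact ball a minimum exists by continuity.\<close>

lemma nonneg_poly_attains_inf:
  fixes f :: "real poly"
  assumes "\<And>t. poly f t \<ge> 0"
  obtains r where "\<And>t. poly f r \<le> poly f t"
proof (cases "degree f = 0")
  case True
  then obtain c where "f = [:c:]" using degree_eq_zeroE by blast
  then show ?thesis using that[of 0] by simp
next
  case False
  obtain a g where f: "f = pCons a g" by (cases f)
  with False have "g \<noteq> 0" by auto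
  from poly_infinity[OF this, of "poly f 0" a]
  obtain R where R: "\<And>t. R \<le> norm t \<Longrightarrow> poly f 0 \<le> norm (poly f t)"
    unfolding f by blast
  \<comment> \<open>\<open>R\<close> may be negative; with \<bar>R\<bar> the ball still contains 0,
    whose value is the one compared with outside.\<close>
  have "\<exists>r\<in>cball 0 \<bar>R\<bar>. \<forall>t\<in>cball 0 \<bar>R\<bar>. poly f r \<le> poly f t"
    by (intro continuous_attains_inf) (auto intro!: continuous_intros)
  then obtain r where r: "\<And>t. \<bar>t\<bar> \<le> \<bar>R\<bar> \<Longrightarrow> poly f r \<le> poly f t"
    by (metis mem_cball_0 real_norm_def)
  have "poly f r \<le> poly f t" for t
  proof (cases "\<bar>t\<bar> \<le> \<bar>R\<bar>")
    case False
    then have "poly f 0 \<le> poly f t" using R[of t] assms[of t] by simp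
    then show ?thesis using r[of 0] by simp
  qed (rule r)
  then show ?thesis by (rule that)
qed

text \<open>At a global minimum both f - f(r) and its derivative vanish, so r is a double root. The
  cofactor is nonnegative away from r because (t - r)^2 > 0 there, and at r by continuity.\<close>

lemma poly_global_min_factor:
  fixes f :: "real poly"
  assumes min: "\<And>t. poly f r \<le> poly f t"
  obtains g where "f = [:poly f r:] + [:- r, 1:]\<^sup>2 * g" "\<And>t. poly g t \<ge> 0"
proof -
  define h where "h = f - [:poly f r:]"
  have "poly h r = 0" by (simp add: h_def)
  then obtain k where k: "h = [:- r, 1:] * k"
    unfolding poly_eq_0_iff_dvd by (auto elim: dvdE)
  have "poly (pderiv h) r = 0"
    by (rule DERIV_local_min[OF poly_DERIV, of 1]) (auto simp: h_def min)
  then have "poly k r = 0"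
    unfolding k pderiv_mult by (simp add: pderiv_pCons)
  then obtain g where g: "k = [:- r, 1:] * g"
    unfolding poly_eq_0_iff_dvd by (auto elim: dvdE)
  have h: "h = [:- r, 1:]\<^sup>2 * g" by (simp only: k g power2_eq_square mult.assoc)
  have off: "poly g t \<ge> 0" if "t \<noteq> r" for t
  proof -
    have "(t - r)\<^sup>2 * poly g t = poly f t - poly f r"
      using arg_cong[OF h, of "\<lambda>h. poly h t"] by (simp add: h_def)
    then show ?thesis
      using min[of t] that by (metis diff_ge_0_iff_ge eq_iff_diff_eq_0 zero_le_mult_iff
          zero_less_power2 not_less)
  qed
  have "poly g t \<ge> 0" for t
  proof (cases "t = r")
    case True
    have "(poly g \<longlongrightarrow> poly g r) (at r)"
      using DERIV_isCont[OF poly_DERIV[of g r]] by (simp add: isCont_def)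
    then have "0 \<le> poly g r"
      by (rule tendsto_lowerbound) (use off in \<open>auto simp: eventually_at_filter\<close>)
    then show ?thesis using True by simp
  qed (rule off)
  moreover have "f = [:poly f r:] + [:- r, 1:]\<^sup>2 * g"
    using h by (simp add: h_def algebra_simps)
  ultimately show ?thesis using that by blast
qed

text \<open>Induction on the degree: a polynomial minus its minimum has a double root.\<close>

lemma nonneg_poly_sos:
  fixes f :: "real poly" and g :: "real ^ 'n \<Rightarrow> real"
  assumes "\<And>t. poly f t \<ge> 0" and g: "real_polynomial_function g"
  shows "sos (\<lambda>x. poly f (g x))"
  using assms(1)
proof (induction "degree f" arbitrary: f rule: less_induct)
  case less
  obtain r where min: "\<And>t. poly f r \<le> poly f t"
    using nonneg_poly_attains_inf less.prems by blast
  from poly_global_min_factor[OF this] obtain h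
    where f: "f = [:poly f r:] + [:- r, 1:]\<^sup>2 * h" and h: "\<And>t. poly h t \<ge> 0" by blast
  have "sos (\<lambda>x. poly h (g x))"
  proof (cases "h = 0")
    case True
    then show ?thesis by (simp add: sos_zero)
  next
    case False
    have "degree ([:- r, 1:]\<^sup>2 * h) = 2 + degree h"
      using False by (subst degree_mult_eq) (auto simp: degree_power_eq)
    then have "degree h < degree f"
      by (subst f, subst degree_add_eq_right) auto
    then show ?thesis using less.hyps h by blast
  qed
  then have "sos (\<lambda>x. poly f r + (g x - r)\<^sup>2 * poly h (g x))"
    using less.prems g
    by (intro sos_add sos_const sos_mult_square real_polynomial_function_diff
        real_polynomial_function.intros(2))
  moreover have "poly f (g x) = poly f r + (g x - r)\<^sup>2 * poly h (g x)" for x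
    by (subst f) simp
  ultimately show ?case by simp
qed

section \<open>Closure rules for degree bounds\<close>

lemma polynomial_degree_le_monomial:
  fixes \<alpha> :: "'n::finite \<Rightarrow> nat"
  assumes "(\<Sum>i\<in>UNIV. \<alpha> i) \<le> d"
  shows "polynomial_degree_le d (\<lambda>x. \<Prod>i\<in>UNIV. x $ i ^ \<alpha> i)"
proof -
  have "(\<Sum>\<beta> | (\<Sum>i\<in>UNIV. \<beta> i) \<le> d. (if \<beta> = \<alpha> then 1 else 0) * (\<Prod>i\<in>UNIV. x $ i ^ \<beta> i))
      = (\<Prod>i\<in>UNIV. x $ i ^ \<alpha> i)" for x :: "real ^ 'n"
    using assms by (simp add: if_distrib[of "\<lambda>c. c * _"] sum.delta finite_exponents cong: if_cong)
  then show ?thesis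
    unfolding polynomial_degree_le_def by (intro exI[of _ "\<lambda>\<beta>. if \<beta> = \<alpha> then 1 else 0"]) simp
qed

lemma polynomial_degree_le_cmult:
  assumes "polynomial_degree_le d p"
  shows "polynomial_degree_le d (\<lambda>x. c * p x)"
proof -
  obtain b where "p = (\<lambda>x. \<Sum>\<alpha> | (\<Sum>i\<in>UNIV. \<alpha> i) \<le> d. b \<alpha> * (\<Prod>i\<in>UNIV. x $ i ^ \<alpha> i))"
    using assms unfolding polynomial_degree_le_def by blast
  then show ?thesis
    unfolding polynomial_degree_le_def
    by (intro exI[of _ "\<lambda>\<alpha>. c * b \<alpha>"]) (simp add: sum_distrib_left mult.assoc)
qed

lemma polynomial_degree_le_add:
  assumes "polynomial_degree_le d p" "polynomial_degree_le d q"
  shows "polynomial_degree_le d (\<lambda>x. p x + q x)"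
proof -
  obtain b where "p = (\<lambda>x. \<Sum>\<alpha> | (\<Sum>i\<in>UNIV. \<alpha> i) \<le> d. b \<alpha> * (\<Prod>i\<in>UNIV. x $ i ^ \<alpha> i))"
    using assms unfolding polynomial_degree_le_def by blast
  moreover obtain c where "q = (\<lambda>x. \<Sum>\<alpha> | (\<Sum>i\<in>UNIV. \<alpha> i) \<le> d. c \<alpha> * (\<Prod>i\<in>UNIV. x $ i ^ \<alpha> i))"
    using assms unfolding polynomial_degree_le_def by blast
  ultimately show ?thesis
    unfolding polynomial_degree_le_def
    by (intro exI[of _ "\<lambda>\<alpha>. b \<alpha> + c \<alpha>"]) (simp add: sum.distrib distrib_right)
qed

lemma polynomial_degree_le_const: "polynomial_degree_le d (\<lambda>x. c)"
  using polynomial_degree_le_cmult[OF polynomial_degree_le_monomial[of "\<lambda>i. 0"], of d c] by simp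

lemma polynomial_degree_le_sum:
  assumes "\<And>i. i \<in> I \<Longrightarrow> polynomial_degree_le d (p i)"
  shows "polynomial_degree_le d (\<lambda>x. \<Sum>i\<in>I. p i x)"
  using assms
  by (induction I rule: infinite_finite_induct)
     (auto intro: polynomial_degree_le_const polynomial_degree_le_add)

text \<open>Exponent vectors add under multiplication. With d = e = 1 this shows that the squares
  produced by the elimination are quadratic.\<close>

lemma polynomial_degree_le_mult:
  fixes p q :: "real ^ 'n \<Rightarrow> real"
  assumes "polynomial_degree_le d p" "polynomial_degree_le e q"
  shows "polynomial_degree_le (d + e) (\<lambda>x. p x * q x)"
proof -
  obtain b where b: "p = (\<lambda>x. \<Sum>\<alpha> | (\<Sum>i\<in>UNIV. \<alpha> i) \<le> d. b \<alpha> * (\<Prod>i\<in>UNIV. x $ i ^ \<alpha> i))"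
    using assms unfolding polynomial_degree_le_def by blast
  obtain c where c: "q = (\<lambda>x. \<Sum>\<alpha> | (\<Sum>i\<in>UNIV. \<alpha> i) \<le> e. c \<alpha> * (\<Prod>i\<in>UNIV. x $ i ^ \<alpha> i))"
    using assms unfolding polynomial_degree_le_def by blast
  have "p x * q x = (\<Sum>\<alpha> | (\<Sum>i\<in>UNIV. \<alpha> i) \<le> d. \<Sum>\<beta> | (\<Sum>i\<in>UNIV. \<beta> i) \<le> e.
      b \<alpha> * c \<beta> * (\<Prod>i\<in>UNIV. x $ i ^ (\<alpha> i + \<beta> i)))" for x
    unfolding b c sum_product by (simp add: power_add prod.distrib mult_ac)
  moreover have "polynomial_degree_le (d + e) (\<lambda>x. \<Sum>\<alpha> | (\<Sum>i\<in>UNIV. \<alpha> i) \<le> d. \<Sum>\<beta> | (\<Sum>i\<in>UNIV. \<beta> i) \<le> e.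
      b \<alpha> * c \<beta> * (\<Prod>i\<in>UNIV. x $ i ^ (\<alpha> i + \<beta> i)) :: real)"
    by (intro polynomial_degree_le_sum polynomial_degree_le_cmult polynomial_degree_le_monomial)
       (auto simp: sum.distrib intro: add_mono)
  ultimately show ?thesis by simp
qed

lemma prod_if_eq_power:
  fixes x :: "real ^ 'n"
  shows "(\<Prod>i\<in>UNIV. x $ i ^ (if i = j then Suc (\<beta> i) else \<beta> i)) = x $ j * (\<Prod>i\<in>UNIV. x $ i ^ \<beta> i)"
proof -
  have "(\<Prod>i\<in>UNIV. x $ i ^ (if i = j then Suc (\<beta> i) else \<beta> i))
      = (\<Prod>i\<in>UNIV. (if i = j then x $ i else 1) * x $ i ^ \<beta> i)"
    by (intro prod.cong) auto
  then show ?thesis by (simp add: prod.distrib prod.delta)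
qed

lemma polynomial_degree_le_coord: "polynomial_degree_le 1 (\<lambda>x :: real ^ 'n. x $ j)"
  using polynomial_degree_le_monomial[of "\<lambda>i. if i = j then Suc 0 else 0" 1]
    prod_if_eq_power[of _ j "\<lambda>_. 0"] by simp

section \<open>Quadratic polynomials in coefficient form\<close>

text \<open>A positive total degree makes some exponent nonzero, and lowering it by one splits off
  that variable. Two applications turn a monomial of degree 2 into a product of two
  coordinates.\<close>

lemma monomial_Suc_degree:
  fixes \<alpha> :: "'n::finite \<Rightarrow> nat"
  assumes "(\<Sum>i\<in>UNIV. \<alpha> i) = Suc d"
  obtains j \<beta> where "(\<Sum>i\<in>UNIV. \<beta> i) = d"
    "\<And>x :: real ^ 'n. (\<Prod>i\<in>UNIV. x $ i ^ \<alpha> i) = x $ j * (\<Prod>i\<in>UNIV. x $ i ^ \<beta> i)"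
proof -
  have "\<exists>j. \<alpha> j \<noteq> 0"
    using assms by (metis sum.neutral nat.distinct(1))
  then obtain j where j: "\<alpha> j \<noteq> 0" by blast
  define \<beta> where "\<beta> = \<alpha>(j := \<alpha> j - 1)"
  have \<alpha>: "\<alpha> = (\<lambda>i. if i = j then Suc (\<beta> i) else \<beta> i)"
    using j by (auto simp: \<beta>_def)
  have "\<alpha> i = (if i = j then 1 else 0) + \<beta> i" for i
    by (subst \<alpha>) simp
  then have "(\<Sum>i\<in>UNIV. \<alpha> i) = 1 + (\<Sum>i\<in>UNIV. \<beta> i)"
    by (simp add: sum.distrib)
  with assms have "(\<Sum>i\<in>UNIV. \<beta> i) = d" by simp
  moreover have "(\<Prod>i\<in>UNIV. x $ i ^ \<alpha> i) = x $ j * (\<Prod>i\<in>UNIV. x $ i ^ \<beta> i)" for x :: "real ^ 'n"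
    by (subst \<alpha>) (rule prod_if_eq_power)
  ultimately show ?thesis by (rule that)
qed

text \<open>Indexing coefficients by variables rather than by exponent vectors suits completing the
  square. \<open>A\<close> is an arbitrary matrix, so for distinct k, l the coefficient of x_k x_l
  is A k l + A l k.\<close>

definition quadratic_expansion :: "(real ^ 'n \<Rightarrow> real) \<Rightarrow> bool" where
  "quadratic_expansion q \<longleftrightarrow> (\<exists>c b A. q = (\<lambda>x. c + (\<Sum>k\<in>UNIV. b k * x $ k)
     + (\<Sum>k\<in>UNIV. \<Sum>l\<in>UNIV. A k l * x $ k * x $ l)))"

lemma quadratic_expansion_add:
  assumes "quadratic_expansion p" "quadratic_expansion q"
  shows "quadratic_expansion (\<lambda>x. p x + q x)"
proof -
  obtain c b A where p: "p = (\<lambda>x. c + (\<Sum>k\<in>UNIV. b k * x $ k)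
     + (\<Sum>k\<in>UNIV. \<Sum>l\<in>UNIV. A k l * x $ k * x $ l))"
    using assms(1) unfolding quadratic_expansion_def by blast
  obtain c' b' A' where q: "q = (\<lambda>x. c' + (\<Sum>k\<in>UNIV. b' k * x $ k)
     + (\<Sum>k\<in>UNIV. \<Sum>l\<in>UNIV. A' k l * x $ k * x $ l))"
    using assms(2) unfolding quadratic_expansion_def by blast
  show ?thesis
    unfolding quadratic_expansion_def
    by (intro exI[of _ "c + c'"] exI[of _ "\<lambda>k. b k + b' k"] exI[of _ "\<lambda>k l. A k l + A' k l"])
       (simp add: p q sum.distrib distrib_right add_ac)
qed

lemma quadratic_expansion_cmult:
  assumes "quadratic_expansion p"
  shows "quadratic_expansion (\<lambda>x. a * p x)"
proof -
  obtain c b A where p: "p = (\<lambda>x. c + (\<Sum>k\<in>UNIV. b k * x $ k)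
     + (\<Sum>k\<in>UNIV. \<Sum>l\<in>UNIV. A k l * x $ k * x $ l))"
    using assms(1) unfolding quadratic_expansion_def by blast
  show ?thesis
    unfolding quadratic_expansion_def
    by (intro exI[of _ "a * c"] exI[of _ "\<lambda>k. a * b k"] exI[of _ "\<lambda>k l. a * A k l"])
       (simp add: p sum_distrib_left distrib_left mult.assoc)
qed

lemma quadratic_expansion_const: "quadratic_expansion (\<lambda>x. c)"
  unfolding quadratic_expansion_def
  by (intro exI[of _ c] exI[of _ "\<lambda>_. 0"] exI[of _ "\<lambda>_ _. 0"]) simp

lemma quadratic_expansion_coord: "quadratic_expansion (\<lambda>x. x $ j)"
  unfolding quadratic_expansion_def
  by (intro exI[of _ 0] exI[of _ "\<lambda>k. if k = j then 1 else 0"] exI[of _ "\<lambda>_ _. 0"])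
     (simp add: if_distrib[of "\<lambda>c. c * _"] cong: if_cong)

lemma quadratic_expansion_coord_mult: "quadratic_expansion (\<lambda>x. x $ i * x $ j)"
proof -
  have "(\<Sum>k\<in>UNIV. \<Sum>l\<in>UNIV. (if k = i then if l = j then 1 else 0 else 0) * x $ k * x $ l)
      = (\<Sum>k\<in>UNIV. if k = i then x $ i * x $ j else 0)" for x :: "real ^ 'a"
    by (intro sum.cong refl) (simp add: if_distrib[of "\<lambda>c. c * _"] cong: if_cong)
  then show ?thesis
    unfolding quadratic_expansion_def
    by (intro exI[of _ 0] exI[of _ "\<lambda>_. 0"]
        exI[of _ "\<lambda>k l. if k = i then if l = j then 1 else 0 else 0"]) simp
qed

text \<open>Peeling variables off a monomial of degree 0, 1 or 2 yields 1, x_j or x_j x_k;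
  expansions are closed under linear combinations.\<close>

lemma quadratic_polynomial_expansion:
  assumes "quadratic_polynomial q"
  shows "quadratic_expansion q"
proof -
  obtain c where q: "q = (\<lambda>x. \<Sum>\<alpha> | (\<Sum>i\<in>UNIV. \<alpha> i) \<le> 2. c \<alpha> * (\<Prod>i\<in>UNIV. x $ i ^ \<alpha> i))"
    using assms unfolding quadratic_polynomial_def polynomial_degree_le_def by blast
  have mono: "quadratic_expansion (\<lambda>x. \<Prod>i\<in>UNIV. x $ i ^ \<alpha> i)"
    if "(\<Sum>i\<in>UNIV. \<alpha> i) \<le> 2" for \<alpha> :: "'a \<Rightarrow> nat"
  proof -
    have zero: "(\<Prod>i\<in>UNIV. x $ i ^ \<beta> i) = 1" if "(\<Sum>i\<in>UNIV. \<beta> i) = 0"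
      for \<beta> :: "'a \<Rightarrow> nat" and x :: "real ^ 'a"
      using that by simp
    have one: "\<exists>j. \<forall>x :: real ^ 'a. (\<Prod>i\<in>UNIV. x $ i ^ \<beta> i) = x $ j"
      if one_deg: "(\<Sum>i\<in>UNIV. \<beta> i) = Suc 0" for \<beta> :: "'a \<Rightarrow> nat"
      by (rule monomial_Suc_degree[OF one_deg]) (metis zero mult.right_neutral)
    consider "(\<Sum>i\<in>UNIV. \<alpha> i) = 0" | "(\<Sum>i\<in>UNIV. \<alpha> i) = Suc 0" | "(\<Sum>i\<in>UNIV. \<alpha> i) = Suc (Suc 0)"
      using \<open>(\<Sum>i\<in>UNIV. \<alpha> i) \<le> 2\<close> by linarith
    then show ?thesis
    proof cases
      case 1
      then show ?thesis by (simp add: zero quadratic_expansion_const)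
    next
      case 2
      then show ?thesis using one[OF 2] by (auto simp: quadratic_expansion_coord)
    next
      case 3
      obtain j \<beta> where \<beta>: "(\<Sum>i\<in>UNIV. \<beta> i) = Suc 0"
        and \<alpha>: "\<And>x :: real ^ 'a. (\<Prod>i\<in>UNIV. x $ i ^ \<alpha> i) = x $ j * (\<Prod>i\<in>UNIV. x $ i ^ \<beta> i)"
        using monomial_Suc_degree[OF 3] by blast
      obtain k where "\<And>x :: real ^ 'a. (\<Prod>i\<in>UNIV. x $ i ^ \<beta> i) = x $ k"
        using one[OF \<beta>] by blast
      then show ?thesis by (simp add: \<alpha> quadratic_expansion_coord_mult)
    qed
  qed
  have "quadratic_expansion (\<lambda>x. \<Sum>\<alpha>\<in>M. c \<alpha> * (\<Prod>i\<in>UNIV. x $ i ^ \<alpha> i))"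
    if "M \<subseteq> {\<alpha>. (\<Sum>i\<in>UNIV. \<alpha> i) \<le> 2}" "finite M" for M
    using that(2,1)
    by (induction M rule: finite_induct)
       (auto intro!: quadratic_expansion_const quadratic_expansion_add quadratic_expansion_cmult mono)
  then show ?thesis unfolding q using finite_exponents by blast
qed

section \<open>Elimination of variables by completing the square\<close>

lemma nonneg_quadratic_coeffs:
  fixes a l r :: real
  assumes nn: "\<And>t. a * t\<^sup>2 + l * t + r \<ge> 0"
  shows "a \<ge> 0" and "a = 0 \<Longrightarrow> l = 0" and "a > 0 \<Longrightarrow> r - l\<^sup>2 / (4 * a) \<ge> 0"
proof -
  show "a \<ge> 0"
  proof (rule ccontr)
    assume "\<not> a \<ge> 0"
    \<comment> \<open>Chosen so that a t^2 \<le> a - \<bar>r\<bar>, whence a t^2 + r \<le> a < 0.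
      Adding the inequalities at t and -t cancels the linear term.\<close>
    define t where "t = 1 + \<bar>r\<bar> / (- a)"
    have "t \<ge> 1" "- a * t = - a + \<bar>r\<bar>"
      using \<open>\<not> a \<ge> 0\<close> by (auto simp: t_def field_simps)
    then have "- a * t * t \<ge> (- a + \<bar>r\<bar>) * 1"
      using \<open>\<not> a \<ge> 0\<close> by (simp only: \<open>- a * t = _\<close>) (intro mult_left_mono, auto)
    moreover have "a * t * t + r \<ge> 0"
      using nn[of t] nn[of "- t"] by (simp add: power2_eq_square)
    ultimately show False using \<open>\<not> a \<ge> 0\<close> by (simp add: abs_if split: if_splits)
  qed
  show "l = 0" if "a = 0"
  proof (rule ccontr)
    assume "l \<noteq> 0"
    \<comment> \<open>At this point the function l t + r takes the value -1.\<close>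
    then show False using nn[of "- (r + 1) / l"] that by simp
  qed
  show "r - l\<^sup>2 / (4 * a) \<ge> 0" if "a > 0"
  proof -
    \<comment> \<open>Evaluation at the vertex of the parabola.\<close>
    have "a * (- l / (2 * a))\<^sup>2 + l * (- l / (2 * a)) + r = r - l\<^sup>2 / (4 * a)"
      using that by (simp add: field_simps power2_eq_square)
    then show ?thesis using nn by metis
  qed
qed

text \<open>Eliminates the variables in \<open>S\<close> one at a time by completing the square; the variable
  \<open>x\<^sub>i\<close> of the univariate part is never eliminated.\<close>

lemma nonneg_partially_quadratic_decomposition:
  fixes f :: "real poly" and i :: "'n::finite" and A :: "'n \<Rightarrow> 'n \<Rightarrow> real"
  assumes "finite S" "i \<notin> S"
    and "\<And>x :: real ^ 'n. 0 \<le> poly f (x $ i) + (\<Sum>k\<in>S. (b k + c k * x $ i) * x $ k)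
           + (\<Sum>k\<in>S. \<Sum>l\<in>S. A k l * x $ k * x $ l)"
  shows "\<exists>v g. (\<forall>t. poly v t \<ge> 0) \<and> quadratic_polynomial g \<and> sos g \<and>
     (\<forall>x :: real ^ 'n. poly f (x $ i) + (\<Sum>k\<in>S. (b k + c k * x $ i) * x $ k)
           + (\<Sum>k\<in>S. \<Sum>l\<in>S. A k l * x $ k * x $ l) = poly v (x $ i) + g x)"
  using assms
\<comment> \<open>Completing the square alters all coefficients, including those coupling x_i to the
  other variables.\<close>
proof (induction S arbitrary: f b c A rule: finite_induct)
  case empty
  have "poly f t \<ge> 0" for t
    using empty(2)[of "\<chi> k. t"] by simp
  then show ?case
    by (intro exI[of _ f] exI[of _ "\<lambda>x. 0"])
       (auto simp: quadratic_polynomial_def polynomial_degree_le_const sos_zero)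
next
  case (insert j S)
  have ij: "i \<noteq> j" "i \<notin> S" using insert.prems by auto
  \<comment> \<open>\<open>a\<close> and \<open>l\<close> collect the coefficients of x_j^2 and x_j,
    and \<open>r\<close> the terms free of x_j; \<open>B\<close> adds the two entries of
    \<open>A\<close> that contribute to x_j x_k.\<close>
  define a where "a = A j j"
  define B where "B k = A j k + A k j" for k
  define l where "l x = b j + c j * x $ i + (\<Sum>k\<in>S. B k * x $ k)" for x :: "real ^ 'n"
  define r where "r x = poly f (x $ i) + (\<Sum>k\<in>S. (b k + c k * x $ i) * x $ k)
           + (\<Sum>k\<in>S. \<Sum>l\<in>S. A k l * x $ k * x $ l)" for x :: "real ^ 'n"
  have split: "poly f (x $ i) + (\<Sum>k\<in>insert j S. (b k + c k * x $ i) * x $ k)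
           + (\<Sum>k\<in>insert j S. \<Sum>l\<in>insert j S. A k l * x $ k * x $ l)
      = a * (x $ j)\<^sup>2 + l x * x $ j + r x" for x
    using insert.hyps
    by (simp add: a_def B_def l_def r_def sum.distrib algebra_simps power2_eq_square
        sum_distrib_left sum_distrib_right)
  \<comment> \<open>Since \<open>l\<close> and \<open>r\<close> ignore x_j, that coordinate can be
    replaced by an arbitrary t with the others fixed.\<close>
  have nn: "0 \<le> a * t\<^sup>2 + l x * t + r x" for x t
  proof -
    define y where "y = (\<chi> k. if k = j then t else x $ k)"
    have S: "y $ k = x $ k" if "k \<in> S" for k
      using that insert.hyps by (auto simp: y_def)
    have ys: "y $ j = t" "y $ i = x $ i"
      using ij by (auto simp: y_def)
    have "l y = l x" "r y = r x"
      unfolding l_def r_def by (simp_all add: ys S)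
    then show ?thesis
      using insert.prems(2)[of y] unfolding split by (simp add: ys)
  qed
  note coeffs = nonneg_quadratic_coeffs[OF nn]
  consider "a = 0" | "a > 0" using coeffs(1) by fastforce
  then show ?case
  proof cases
    case 1
    have eq: "a * (x $ j)\<^sup>2 + l x * x $ j + r x = r x" for x
      using coeffs(2)[OF 1] 1 by simp
    have "0 \<le> r x" for x using nn[of 0 x] by simp
    then show ?thesis
      unfolding split eq unfolding r_def using ij(2) by (intro insert.IH)
  next
    case 2
    \<comment> \<open>The coefficients of r - l^2/(4a): the square of b_j + c_j x_i goes into
      \<open>f'\<close>, its cross terms with the sum of the B_k x_k into \<open>b'\<close> and
      \<open>c'\<close>, and the square of that sum into \<open>A'\<close>.\<close>
    define f' where "f' = f - smult (1 / (4 * a)) ([:b j, c j:]\<^sup>2)"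
    define b' where "b' k = b k - b j * B k / (2 * a)" for k
    define c' where "c' k = c k - c j * B k / (2 * a)" for k
    define A' where "A' k m = A k m - B k * B m / (4 * a)" for k m
    have red: "r x - (l x)\<^sup>2 / (4 * a) = poly f' (x $ i)
        + (\<Sum>k\<in>S. (b' k + c' k * x $ i) * x $ k)
        + (\<Sum>k\<in>S. \<Sum>m\<in>S. A' k m * x $ k * x $ m)" for x
    proof -
      \<comment> \<open>With l = e + s, the parts e^2, 2 e s and s^2 of l^2 are matched separately
        by \<open>f\<close>, \<open>lin\<close> and \<open>quad\<close>.\<close>
      define e where "e = b j + c j * x $ i"
      define s where "s = (\<Sum>k\<in>S. B k * x $ k)"
      have f: "poly f' (x $ i) = poly f (x $ i) - e\<^sup>2 / (4 * a)"
        by (simp add: f'_def e_def mult.commute)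
      have "(\<Sum>k\<in>S. (b' k + c' k * x $ i) * x $ k)
          = (\<Sum>k\<in>S. (b k + c k * x $ i) * x $ k - e / (2 * a) * (B k * x $ k))"
        by (intro sum.cong refl) (simp add: b'_def c'_def e_def algebra_simps add_divide_distrib)
      also have "\<dots> = (\<Sum>k\<in>S. (b k + c k * x $ i) * x $ k) - e / (2 * a) * s"
        by (simp add: s_def sum_subtractf sum_distrib_left)
      finally have lin: "(\<Sum>k\<in>S. (b' k + c' k * x $ i) * x $ k) = \<dots>" .
      have "(\<Sum>k\<in>S. \<Sum>m\<in>S. A' k m * x $ k * x $ m)
          = (\<Sum>k\<in>S. \<Sum>m\<in>S. A k m * x $ k * x $ m - (B k * x $ k) * (B m * x $ m) / (4 * a))"
        by (intro sum.cong refl) (simp add: A'_def algebra_simps)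
      also have "\<dots> = (\<Sum>k\<in>S. \<Sum>m\<in>S. A k m * x $ k * x $ m) - s * s / (4 * a)"
        by (simp add: s_def sum_subtractf sum_product sum_divide_distrib)
      finally have quad: "(\<Sum>k\<in>S. \<Sum>m\<in>S. A' k m * x $ k * x $ m) = \<dots>" .
      have "l x = e + s" by (simp add: l_def e_def s_def)
      then show ?thesis
        unfolding f lin quad r_def using 2 by (simp add: field_simps power2_eq_square)
    qed
    have "0 \<le> r x - (l x)\<^sup>2 / (4 * a)" for x using coeffs(3)[OF 2] .
    then obtain v g where v: "\<forall>t. poly v t \<ge> 0" and g: "quadratic_polynomial g" "sos g"
      and vg: "\<And>x. r x - (l x)\<^sup>2 / (4 * a) = poly v (x $ i) + g x"
      using insert.IH[OF ij(2), of f' b' c' A'] unfolding red by blast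
    \<comment> \<open>The completed square a (x_j + l/(2a))^2 as the square of a single affine
      function.\<close>
    define h where "h x = sqrt a * (x $ j + 1 / (2 * a) * l x)" for x
    have "polynomial_degree_le 1 l"
      unfolding l_def
      by (intro polynomial_degree_le_add polynomial_degree_le_const polynomial_degree_le_sum
          polynomial_degree_le_cmult polynomial_degree_le_coord)
    then have h: "polynomial_degree_le 1 h"
      unfolding h_def
      by (intro polynomial_degree_le_add polynomial_degree_le_cmult polynomial_degree_le_coord)
    have "quadratic_polynomial (\<lambda>x. g x + (h x)\<^sup>2)"
      using polynomial_degree_le_add[OF _ polynomial_degree_le_mult[OF h h], of g] g(1)
      by (simp add: quadratic_polynomial_def power2_eq_square numeral_2_eq_2)
    moreover have "sos (\<lambda>x. g x + (h x)\<^sup>2)"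
      using g(2) h by (intro sos_add_square polynomial_degree_le_imp_real_polynomial_function)
    moreover have "a * (x $ j)\<^sup>2 + l x * x $ j + r x = poly v (x $ i) + (g x + (h x)\<^sup>2)" for x
    proof -
      have "(h x)\<^sup>2 = a * (x $ j + 1 / (2 * a) * l x)\<^sup>2"
        using 2 by (simp add: h_def power_mult_distrib)
      also have "\<dots> = a * (x $ j)\<^sup>2 + l x * x $ j + (l x)\<^sup>2 / (4 * a)"
        using 2 by (simp add: field_simps power2_eq_square)
      finally show ?thesis using vg[of x] by simp
    qed
    ultimately show ?thesis unfolding split using v by blast
  qed
qed

section \<open>Isolating the distinguished variable, and the conclusion\<close>

lemma quadratic_expansion_split:
  fixes q :: "real ^ 'n \<Rightarrow> real"
  assumes "quadratic_expansion q"
  obtains f b c A where "\<And>x. q x = poly f (x $ i) + (\<Sum>k\<in>- {i}. (b k + c k * x $ i) * x $ k)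
           + (\<Sum>k\<in>- {i}. \<Sum>l\<in>- {i}. A k l * x $ k * x $ l)"
proof -
  obtain d b A where q: "q = (\<lambda>x. d + (\<Sum>k\<in>UNIV. b k * x $ k)
     + (\<Sum>k\<in>UNIV. \<Sum>l\<in>UNIV. A k l * x $ k * x $ l))"
    using assms unfolding quadratic_expansion_def by blast
  have U: "sum h UNIV = h i + sum h (- {i})" for h :: "'n \<Rightarrow> real"
    by (simp add: sum.remove[of UNIV i] Compl_eq_Diff_UNIV)
  show ?thesis
    \<comment> \<open>The terms in x_i alone form the polynomial d + b_i t + A_ii t^2; the mixed
      terms x_i x_k give the slope of the coefficient of x_k.\<close>
    by (rule that[of "[:d, b i, A i i:]" b "\<lambda>k. A i k + A k i" A])
       (simp add: q U sum.distrib algebra_simps sum_distrib_left)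
qed

theorem theorem2p2:
  fixes p :: "real ^ 'n \<Rightarrow> real"
  assumes "real_polynomial_function p"
    and "\<exists>u q. univariate_polynomial u \<and> quadratic_polynomial q \<and> p = (\<lambda>x. u x + q x)"
  shows "(nonnegative p \<longrightarrow>
            (\<exists>u q. univariate_polynomial u \<and> nonnegative u \<and>
                   quadratic_polynomial q \<and> nonnegative q \<and> p = (\<lambda>x. u x + q x)))
         \<and> (nonnegative p \<longleftrightarrow> sos p)"
proof -
  \<comment> \<open>The sum-of-squares property of both summands is recorded along with the
    decomposition, so that adding them also settles the equivalence.\<close>
  have main: "\<exists>u q. univariate_polynomial u \<and> nonnegative u \<and> sos u \<and>
      quadratic_polynomial q \<and> nonnegative q \<and> sos q \<and> p = (\<lambda>x. u x + q x)"
    if "nonnegative p"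
  proof -
    obtain i f0 q where q: "quadratic_polynomial q" and p: "p = (\<lambda>x. poly f0 (x $ i) + q x)"
      using assms(2) unfolding univariate_polynomial_def by blast
    obtain f b c A where "\<And>x. q x = poly f (x $ i) + (\<Sum>k\<in>- {i}. (b k + c k * x $ i) * x $ k)
           + (\<Sum>k\<in>- {i}. \<Sum>l\<in>- {i}. A k l * x $ k * x $ l)"
      using quadratic_expansion_split[OF quadratic_polynomial_expansion[OF q]] by blast
    then have p_eq: "p x = poly (f0 + f) (x $ i) + (\<Sum>k\<in>- {i}. (b k + c k * x $ i) * x $ k)
           + (\<Sum>k\<in>- {i}. \<Sum>l\<in>- {i}. A k l * x $ k * x $ l)" for x
      by (simp add: p)
    have "\<exists>v g. (\<forall>t. poly v t \<ge> 0) \<and> quadratic_polynomial g \<and> sos g \<and>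
        (\<forall>x. p x = poly v (x $ i) + g x)"
      unfolding p_eq
    proof (rule nonneg_partially_quadratic_decomposition)
      show "0 \<le> poly (f0 + f) (x $ i) + (\<Sum>k\<in>- {i}. (b k + c k * x $ i) * x $ k)
           + (\<Sum>k\<in>- {i}. \<Sum>l\<in>- {i}. A k l * x $ k * x $ l)" for x
        using that unfolding nonnegative_def p_eq by blast
    qed auto
    then obtain v g where v: "\<And>t. poly v t \<ge> 0" and g: "quadratic_polynomial g" "sos g"
      and vg: "p = (\<lambda>x. poly v (x $ i) + g x)"
      by blast
    have "univariate_polynomial (\<lambda>x. poly v (x $ i))"
      unfolding univariate_polynomial_def by blast
    moreover have "sos (\<lambda>x. poly v (x $ i))"
      using v by (intro nonneg_poly_sos real_polynomial_function_coord)
    ultimately show ?thesis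
      using g vg sos_imp_nonnegative by blast
  qed
  then show ?thesis
    using sos_add sos_imp_nonnegative by metis
qed

end
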